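(* Let $\alpha_c,\alpha_p,c_*>0$, $K_c(t)=1-e^{-\alpha_ct}$ and $K_p(t)=1-e^{-\alpha_pt}$ for $t\ge0$. Then for $L_2>0$ the inequality $$\int_0^{+\infty}e^{L_2z}\,dF(z)\int_0^\infty e^{-c_*L_2t}(1-K_p(t))\,dK_c(t)+\int_0^{+\infty}e^{-L_2z}\,dG(z)\int_0^\infty e^{-c_*L_2t}(1-K_c(t))\,dK_p(t)\le1$$ takes the form $$\frac{\alpha_c}{\alpha_c+\alpha_p+c_*L_2}\int_0^{+\infty}e^{L_2z}\,dF(z)+\frac{\alpha_p}{\alpha_c+\alpha_p+c_*L_2}\int_0^{+\infty}e^{-L_2z}\,dG(z)\le1.$$ If, as $L_2\to0+$, $\int_0^{+\infty}e^{L_2z}\,dF(z)=1+\mu_cL_2+o(L_2)$ and $\int_0^{+\infty}e^{-L_2z}\,dG(z)=1-\mu_pL_2+o(L_2)$, where $\mu_c$ and $\mu_p$ are the means of the distributions $F$ and $G$, then a solution $L_2>0$ of this inequality exists provided $\alpha_c\mu_c<\alpha_p\mu_p+c_*$.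
   Context: $F$ and $G$ are distribution functions of nonnegative random variables (claims and premiums); integrals are Lebesgue–Stieltjes integrals. *)

theory Defs
  imports "HOL-Probability.Probability"
begin

definition nonneg_distribution_function :: "(real \<Rightarrow> real) \<Rightarrow> bool" where
  "nonneg_distribution_function F \<longleftrightarrow>
     (\<exists>M. real_distribution M \<and> (AE x in M. 0 \<le> x) \<and> F = cdf M)"

text \<open>The Lebesgue--Stieltjes integral of a nonnegative function over the closed half-line, with
  values in $[0,\infty]$. An atom of the integrator at the origin is counted, and the exponential
  moments of a heavy-tailed distribution are allowed to be infinite. The symbol \<^const>\<open>ennreal\<close> sends
  negative numbers to \<open>0\<close>, so the integrand has to be nonnegative.\<close>

definition stieltjes_integral :: "(real \<Rightarrow> real) \<Rightarrow> (real \<Rightarrow> real) \<Rightarrow> ennreal" where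
  "stieltjes_integral f F = (\<integral>\<^sup>+z\<in>{0..}. ennreal (f z) \<partial>interval_measure F)"

definition is_mean :: "(real \<Rightarrow> real) \<Rightarrow> real \<Rightarrow> bool" where
  "is_mean F \<mu> \<longleftrightarrow> has_bochner_integral (interval_measure F) (\<lambda>z. z) \<mu>"

text \<open>The value \<open>0\<close> on the negative half-line makes this a distribution function on the
  whole line, as \<^const>\<open>interval_measure\<close> requires.\<close>

definition exp_distribution_function :: "real \<Rightarrow> real \<Rightarrow> real" where
  "exp_distribution_function \<alpha> t = (if 0 \<le> t then 1 - exp (- \<alpha> * t) else 0)"

definition general_lhs ::
  "(real \<Rightarrow> real) \<Rightarrow> (real \<Rightarrow> real) \<Rightarrow> (real \<Rightarrow> real) \<Rightarrow> (real \<Rightarrow> real) \<Rightarrow> real \<Rightarrow> real \<Rightarrow> ennreal" where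
  "general_lhs F G K\<^sub>c K\<^sub>p c L =
     stieltjes_integral (\<lambda>z. exp (L * z)) F
       * stieltjes_integral (\<lambda>t. exp (- c * L * t) * (1 - K\<^sub>p t)) K\<^sub>c
     + stieltjes_integral (\<lambda>z. exp (- L * z)) G
       * stieltjes_integral (\<lambda>t. exp (- c * L * t) * (1 - K\<^sub>c t)) K\<^sub>p"

definition exponential_lhs ::
  "(real \<Rightarrow> real) \<Rightarrow> (real \<Rightarrow> real) \<Rightarrow> real \<Rightarrow> real \<Rightarrow> real \<Rightarrow> real \<Rightarrow> ennreal" where
  "exponential_lhs F G \<alpha>\<^sub>c \<alpha>\<^sub>p c L =
     ennreal (\<alpha>\<^sub>c / (\<alpha>\<^sub>c + \<alpha>\<^sub>p + c * L)) * stieltjes_integral (\<lambda>z. exp (L * z)) F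
     + ennreal (\<alpha>\<^sub>p / (\<alpha>\<^sub>c + \<alpha>\<^sub>p + c * L)) * stieltjes_integral (\<lambda>z. exp (- L * z)) G"

text \<open>\<open>\<Phi>(L) = 1 + a L + o(L)\<close> as \<open>L \<rightarrow> 0+\<close>; in particular \<open>\<Phi>\<close> is finite near \<open>0\<close>.\<close>

definition first_order_expansion :: "(real \<Rightarrow> ennreal) \<Rightarrow> real \<Rightarrow> bool" where
  "first_order_expansion \<Phi> a \<longleftrightarrow>
     (\<exists>r \<in> o[at_right 0](\<lambda>L. L). \<forall>\<^sub>F L in at_right 0. \<Phi> L = ennreal (1 + a * L + r L))"

end

theory Submission
  imports Defs
begin

text \<open>For exponential \<open>K\<^sub>c\<close> and \<open>K\<^sub>p\<close> the integrand against \<open>dK\<^sub>c\<close> is a constant multiple of the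
  exponential density with rate \<open>s = \<alpha>\<^sub>c + \<alpha>\<^sub>p + c L\<close>, whose total mass is one; this yields the
  factor \<open>\<alpha>\<^sub>c / s\<close>, and symmetrically \<open>\<alpha>\<^sub>p / s\<close>. After multiplication by \<open>s\<close>, the
  inequality reads \<open>(\<alpha>\<^sub>c \<mu>\<^sub>c - \<alpha>\<^sub>p \<mu>\<^sub>p - c) L + o(L) \<le> 0\<close> near the origin, where the
  negative linear term dominates.\<close>

text \<open>A distribution on the line is determined by its distribution function, and both measures
  have \<open>cdf M\<close> as theirs.\<close>

lemma interval_measure_cdf:
  assumes "real_distribution M"
  shows "interval_measure (cdf M) = M"
proof -
  interpret real_distribution M by fact
  have "real_distribution (interval_measure (cdf M))"
    by (intro real_distribution_interval_measure cdf_nondecreasing cdf_is_right_cont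
        cdf_lim_at_bot cdf_lim_at_top_prob)
  moreover have "cdf (interval_measure (cdf M)) = cdf M"
    by (intro cdf_interval_measure cdf_nondecreasing cdf_is_right_cont
        cdf_lim_at_bot cdf_lim_at_top_prob)
  ultimately show ?thesis
    using assms by (intro cdf_unique)
qed

text \<open>The exponential density is the Erlang density of shape 0, so its known distribution
  function identifies the Stieltjes measure. This turns integrals against it into Lebesgue
  integrals.\<close>

lemma interval_measure_exp_distribution_function:
  assumes "0 < \<alpha>"
  shows "interval_measure (exp_distribution_function \<alpha>) = density lborel (exponential_density \<alpha>)"
proof -
  let ?D = "density lborel (exponential_density \<alpha>)"
  interpret prob_space ?D
    using assms by (rule prob_space_erlang_density)
  have D: "real_distribution ?D"
    by unfold_locales simp_all
  have "cdf ?D = exp_distribution_function \<alpha>"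
  proof
    fix x
    \<comment> \<open>\<open>emeasure_erlang_density\<close> gives the value as an
      \<open>ennreal\<close>; nonnegativity lets \<open>measure\<close> return the same real
      number.\<close>
    have "0 \<le> erlang_CDF 0 \<alpha> x"
      using assms by (simp add: erlang_CDF_0)
    then show "cdf ?D x = exp_distribution_function \<alpha> x"
      using assms
      by (simp add: cdf_def measure_def emeasure_erlang_density erlang_CDF_0
          exp_distribution_function_def)
  qed
  with interval_measure_cdf[OF D] show ?thesis
    by simp
qed

lemma nn_integral_exponential_density:
  assumes "0 < s"
  shows "(\<integral>\<^sup>+t. ennreal (exponential_density s t) \<partial>lborel) = 1"
  using nn_integral_erlang_ith_moment[OF assms, of 0 0] by simp

text \<open>For d > 0 the value is the probability that, of three independent exponential clocks
  with rates \<alpha>, \<beta> and d, the one with rate \<alpha> rings first.\<close>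

lemma stieltjes_integral_exp_distribution_function:
  assumes "0 < \<alpha>" "0 < \<beta>" "0 \<le> d"
  shows "stieltjes_integral (\<lambda>t. exp (- d * t) * (1 - exp_distribution_function \<beta> t))
           (exp_distribution_function \<alpha>) = ennreal (\<alpha> / (\<alpha> + \<beta> + d))"
proof -
  define s where "s = \<alpha> + \<beta> + d"
  have s: "0 < s"
    using assms by (simp add: s_def)
  have [measurable]: "exp_distribution_function \<beta> \<in> borel_measurable borel"
    unfolding exp_distribution_function_def[abs_def] by measurable
  \<comment> \<open>The equation holds on the whole line: for negative t both densities
    vanish.\<close>
  have pointwise: "ennreal (exponential_density \<alpha> t) *
      (ennreal (exp (- d * t) * (1 - exp_distribution_function \<beta> t)) * indicator {0..} t)
      = ennreal (\<alpha> / s) * ennreal (exponential_density s t)" for t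
  proof (cases "0 \<le> t")
    case True
    have "exponential_density \<alpha> t * (exp (- d * t) * (1 - exp_distribution_function \<beta> t))
        = \<alpha> / s * exponential_density s t"
    proof -
      have "exp (- t * \<alpha>) * (exp (- d * t) * exp (- \<beta> * t)) = exp (- t * s)"
        by (simp add: s_def mult_exp_exp algebra_simps)
      then show ?thesis
        using True s by (simp add: exponential_density_def exp_distribution_function_def)
    qed
    then show ?thesis
      using True assms s by (simp add: ennreal_mult' [symmetric])
  qed (simp add: exponential_density_def)
  have "stieltjes_integral (\<lambda>t. exp (- d * t) * (1 - exp_distribution_function \<beta> t))
           (exp_distribution_function \<alpha>)
      = (\<integral>\<^sup>+t. ennreal (\<alpha> / s) * ennreal (exponential_density s t) \<partial>lborel)"
    using assms
    by (simp add: stieltjes_integral_def interval_measure_exp_distribution_function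
        nn_integral_density flip: pointwise)
  also have "\<dots> = ennreal (\<alpha> / s)"
    using s by (simp add: nn_integral_cmult nn_integral_exponential_density)
  finally show ?thesis
    by (simp add: s_def)
qed

text \<open>Both time integrals are the preceding one with d = c * L, the second with the two rates
  exchanged.\<close>

lemma general_lhs_exp_distribution_function:
  assumes "0 < \<alpha>" "0 < \<beta>" "0 \<le> c" "0 \<le> L"
  shows "general_lhs F G (exp_distribution_function \<alpha>) (exp_distribution_function \<beta>) c L
    = exponential_lhs F G \<alpha> \<beta> c L"
  using stieltjes_integral_exp_distribution_function[of \<alpha> \<beta> "c * L"]
    stieltjes_integral_exp_distribution_function[of \<beta> \<alpha> "c * L"] assms
  by (simp add: general_lhs_def exponential_lhs_def mult.commute add.commute)

text \<open>Near 0 the remainder is at most \<epsilon> * L in absolute value, so it is absorbed into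
  the slope.\<close>

lemma first_order_expansion_bound:
  assumes "first_order_expansion \<Phi> a" "0 < \<epsilon>"
  shows "\<forall>\<^sub>F L in at_right 0. \<Phi> L \<le> ennreal (1 + (a + \<epsilon>) * L)"
proof -
  obtain r where r: "r \<in> o[at_right 0](\<lambda>L. L)"
    and eq: "\<forall>\<^sub>F L in at_right 0. \<Phi> L = ennreal (1 + a * L + r L)"
    using assms(1) by (auto simp: first_order_expansion_def)
  show ?thesis
    using eq landau_o.smallD[OF r assms(2)] eventually_at_right_less[of 0]
  proof eventually_elim
    case (elim L)
    then show ?case
      by (auto intro!: ennreal_leI simp: algebra_simps)
  qed
qed

text \<open>Serves to keep the linear bounds out of the range where \<open>ennreal\<close> truncates
  to 0, so that they can be combined as real numbers.\<close>

lemma eventually_linear_pos: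
  "\<forall>\<^sub>F L in at_right 0. 0 < 1 + a * (L::real)"
proof -
  have "((\<lambda>L. 1 + a * L) \<longlongrightarrow> 1 + a * 0) (at_right 0)"
    by (intro tendsto_intros)
  then show ?thesis
    by (rule order_tendstoD) simp
qed

lemma exponential_lhs_eventually_le_1:
  assumes "0 < \<alpha>" "0 < \<beta>" "0 \<le> c"
    and F: "first_order_expansion (\<lambda>L. stieltjes_integral (\<lambda>z. exp (L * z)) F) \<mu>"
    and G: "first_order_expansion (\<lambda>L. stieltjes_integral (\<lambda>z. exp (- L * z)) G) (- \<nu>)"
    and less: "\<alpha> * \<mu> < \<beta> * \<nu> + c"
  shows "\<forall>\<^sub>F L in at_right 0. exponential_lhs F G \<alpha> \<beta> c L \<le> 1"
proof -
  \<comment> \<open>The slack in the hypothesis is shared by both slopes, with total weight \<alpha>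
    + \<beta>. The numerator of the bound then has slope exactly c, like the denominator s.\<close>
  define \<epsilon> where "\<epsilon> = (\<beta> * \<nu> + c - \<alpha> * \<mu>) / (\<alpha> + \<beta>)"
  have \<epsilon>: "0 < \<epsilon>"
    using assms by (simp add: \<epsilon>_def)
  have \<epsilon>_eq: "\<alpha> * (\<mu> + \<epsilon>) + \<beta> * (- \<nu> + \<epsilon>) = c"
  proof -
    have "(\<alpha> + \<beta>) * \<epsilon> = \<beta> * \<nu> + c - \<alpha> * \<mu>"
      using assms by (simp add: \<epsilon>_def)
    then show ?thesis
      by (simp add: algebra_simps)
  qed
  show ?thesis
    using first_order_expansion_bound[OF F \<epsilon>] first_order_expansion_bound[OF G \<epsilon>]
      eventually_linear_pos[of "\<mu> + \<epsilon>"] eventually_linear_pos[of "- \<nu> + \<epsilon>"]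
      eventually_at_right_less[of 0]
  proof eventually_elim
    case (elim L)
    define s where "s = \<alpha> + \<beta> + c * L"
    have s: "0 < s"
      using assms elim(5) by (simp add: s_def add_pos_nonneg)
    have "exponential_lhs F G \<alpha> \<beta> c L
        \<le> ennreal (\<alpha> / s) * ennreal (1 + (\<mu> + \<epsilon>) * L)
          + ennreal (\<beta> / s) * ennreal (1 + (- \<nu> + \<epsilon>) * L)"
      unfolding exponential_lhs_def s_def[symmetric]
      using elim(1,2) by (intro add_mono mult_left_mono) simp_all
    also have "\<dots> = ennreal (\<alpha> / s * (1 + (\<mu> + \<epsilon>) * L) + \<beta> / s * (1 + (- \<nu> + \<epsilon>) * L))"
      using assms(1,2) s elim(3,4)
      by (simp only: ennreal_plus ennreal_mult divide_nonneg_pos mult_nonneg_nonneg less_imp_le)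
    also have "\<alpha> / s * (1 + (\<mu> + \<epsilon>) * L) + \<beta> / s * (1 + (- \<nu> + \<epsilon>) * L)
        = (\<alpha> + \<beta> + (\<alpha> * (\<mu> + \<epsilon>) + \<beta> * (- \<nu> + \<epsilon>)) * L) / s"
      by (simp add: add_divide_distrib diff_divide_distrib algebra_simps)
    \<comment> \<open>By the choice of \<epsilon> the numerator is s itself.\<close>
    also have "\<dots> = 1"
      using s by (simp only: \<epsilon>_eq) (simp add: s_def)
    finally show ?case
      by simp
  qed
qed

theorem corollary6p1:
  fixes F G K\<^sub>c K\<^sub>p :: "real \<Rightarrow> real" and \<alpha>\<^sub>c \<alpha>\<^sub>p c :: real
  assumes "nonneg_distribution_function F" and "nonneg_distribution_function G"
    and "\<alpha>\<^sub>c > 0" and "\<alpha>\<^sub>p > 0" and "c > 0"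
    and "K\<^sub>c = exp_distribution_function \<alpha>\<^sub>c" and "K\<^sub>p = exp_distribution_function \<alpha>\<^sub>p"
  shows "(\<forall>L>0. general_lhs F G K\<^sub>c K\<^sub>p c L = exponential_lhs F G \<alpha>\<^sub>c \<alpha>\<^sub>p c L
            \<and> (general_lhs F G K\<^sub>c K\<^sub>p c L \<le> 1 \<longleftrightarrow> exponential_lhs F G \<alpha>\<^sub>c \<alpha>\<^sub>p c L \<le> 1))
    \<and> (\<forall>\<mu>\<^sub>c \<mu>\<^sub>p. is_mean F \<mu>\<^sub>c \<longrightarrow> is_mean G \<mu>\<^sub>p
         \<longrightarrow> first_order_expansion (\<lambda>L. stieltjes_integral (\<lambda>z. exp (L * z)) F) \<mu>\<^sub>c
         \<longrightarrow> first_order_expansion (\<lambda>L. stieltjes_integral (\<lambda>z. exp (- L * z)) G) (- \<mu>\<^sub>p)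
         \<longrightarrow> \<alpha>\<^sub>c * \<mu>\<^sub>c < \<alpha>\<^sub>p * \<mu>\<^sub>p + c
         \<longrightarrow> (\<exists>L>0. exponential_lhs F G \<alpha>\<^sub>c \<alpha>\<^sub>p c L \<le> 1))"
proof (intro conjI allI impI)
  fix L :: real
  assume "0 < L"
  with assms show eq: "general_lhs F G K\<^sub>c K\<^sub>p c L = exponential_lhs F G \<alpha>\<^sub>c \<alpha>\<^sub>p c L"
    by (simp add: general_lhs_exp_distribution_function)
  show "general_lhs F G K\<^sub>c K\<^sub>p c L \<le> 1 \<longleftrightarrow> exponential_lhs F G \<alpha>\<^sub>c \<alpha>\<^sub>p c L \<le> 1"
    by (simp only: eq)
next
  fix \<mu>\<^sub>c \<mu>\<^sub>p
  assume "first_order_expansion (\<lambda>L. stieltjes_integral (\<lambda>z. exp (L * z)) F) \<mu>\<^sub>c"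
    and "first_order_expansion (\<lambda>L. stieltjes_integral (\<lambda>z. exp (- L * z)) G) (- \<mu>\<^sub>p)"
    and "\<alpha>\<^sub>c * \<mu>\<^sub>c < \<alpha>\<^sub>p * \<mu>\<^sub>p + c"
  then have "\<forall>\<^sub>F L in at_right 0. exponential_lhs F G \<alpha>\<^sub>c \<alpha>\<^sub>p c L \<le> 1"
    using assms by (intro exponential_lhs_eventually_le_1) simp_all
  \<comment> \<open>Positivity of L is joined to the inequality first, so that one witness from the
    nontrivial filter \<open>at_right 0\<close> has both properties.\<close>
  with eventually_at_right_less[of 0]
  have "\<forall>\<^sub>F L in at_right 0. 0 < L \<and> exponential_lhs F G \<alpha>\<^sub>c \<alpha>\<^sub>p c L \<le> 1"
    by (rule eventually_conj)
  from eventually_happens[OF this] show "\<exists>L>0. exponential_lhs F G \<alpha>\<^sub>c \<alpha>\<^sub>p c L \<le> 1"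
    by auto
qed

end
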